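(* Let $\omega\in\mathbb{C}$ be a primitive cube root of unity, and let $a,b$ be nonzero complex numbers with $|ab|<1$. Then $$ f(\omega a, \omega b) = \omega f(a, b) + (1 - \omega)\, f(a^6b^3,\, a^3b^6). $$
   Context: Ramanujan's theta function is defined, for complex numbers $x,y$ with $|xy|<1$, by $$f(x,y) = \sum_{n=-\infty}^{\infty} x^{n(n+1)/2}\, y^{n(n-1)/2}.$$ *)

theory Defs
  imports "HOL-Analysis.Analysis"
begin

text \<open>
  The exponents \<open>n(n+1)/2\<close> and \<open>n(n-1)/2\<close> are nonnegative integers for every integer \<open>n\<close>, so
  neither \<open>div\<close> nor \<open>nat\<close> truncates. The bilateral series converges absolutely for \<open>\<bar>xy\<bar> < 1\<close>,
  hence the unordered sum is its value there; the function is only meaningful in that range.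
\<close>
definition ramanujan_theta :: "complex \<Rightarrow> complex \<Rightarrow> complex" where
  "ramanujan_theta x y =
     (\<Sum>\<^sub>\<infinity>n\<in>(UNIV :: int set). x ^ nat (n * (n + 1) div 2) * y ^ nat (n * (n - 1) div 2))"

definition primitive_root_of_unity :: "nat \<Rightarrow> complex \<Rightarrow> bool" where
  "primitive_root_of_unity k w \<longleftrightarrow> k > 0 \<and> w ^ k = 1 \<and> (\<forall>j. 0 < j \<and> j < k \<longrightarrow> w ^ j \<noteq> 1)"

end

theory Submission
  imports Defs
begin

text \<open>
  Since \<open>n(n+1)/2 + n(n-1)/2 = n\<^sup>2\<close>, the general term of \<open>f(\<omega>a, \<omega>b)\<close> is that of \<open>f(a, b)\<close>
  times \<open>\<omega>\<close> to the power \<open>n\<^sup>2\<close>, a factor which is \<open>1\<close> if \<open>3\<close> divides \<open>n\<close> and \<open>\<omega>\<close> otherwise.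
  Hence \<open>f(\<omega>a, \<omega>b) - \<omega> f(a, b)\<close> is \<open>1 - \<omega>\<close> times the part of \<open>f(a, b)\<close> supported on the
  multiples of \<open>3\<close>, and the substitution \<open>n = 3m\<close> turns that part into \<open>f(a\<^sup>6b\<^sup>3, a\<^sup>3b\<^sup>6)\<close>.
\<close>

definition theta_term :: "complex \<Rightarrow> complex \<Rightarrow> int \<Rightarrow> complex" where
  "theta_term x y n = x ^ nat (n * (n + 1) div 2) * y ^ nat (n * (n - 1) div 2)"

lemma ramanujan_theta_eq_infsum: "ramanujan_theta x y = infsum (theta_term x y) UNIV"
  unfolding ramanujan_theta_def theta_term_def ..

text \<open>Consecutive terms have ratio \<open>q ^ k * r\<close>, which tends to 0 however large
  \<open>r\<close> is, so the ratio test applies. With \<open>q\<close> = |xy| and \<open>r\<close>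
  = |x| this bounds one half of the bilateral series.\<close>

lemma summable_power_choose_two:
  fixes q r :: real
  assumes "0 \<le> q" "q < 1" "0 \<le> r"
  shows "summable (\<lambda>k. q ^ (k choose 2) * r ^ k)"
proof -
  have "(\<lambda>k. q ^ k * r) \<longlonglongrightarrow> 0 * r"
    using assms by (intro tendsto_intros LIMSEQ_power_zero) auto
  then have "eventually (\<lambda>k. q ^ k * r < 1 / 2) sequentially"
    by (auto dest: order_tendstoD(2)[where a = "1/2"])
  then obtain N where N: "\<And>k. k \<ge> N \<Longrightarrow> q ^ k * r < 1 / 2"
    by (auto simp: eventually_sequentially)
  show ?thesis
  proof (rule summable_ratio_test[of "1/2" N])
    fix k assume "k \<ge> N"
    have "q ^ (Suc k choose 2) * r ^ Suc k = (q ^ k * r) * (q ^ (k choose 2) * r ^ k)"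
      \<comment> \<open>Writing 2 as a successor exposes Pascal's rule, which gives
        \<open>Suc k choose 2\<close> = \<open>k + (k choose 2)\<close>.\<close>
      by (simp add: numeral_2_eq_2 power_add)
    also have "\<dots> \<le> 1 / 2 * (q ^ (k choose 2) * r ^ k)"
      using N[OF \<open>k \<ge> N\<close>] assms by (intro mult_right_mono) auto
    finally show "norm (q ^ (Suc k choose 2) * r ^ Suc k)
        \<le> 1 / 2 * norm (q ^ (k choose 2) * r ^ k)"
      using assms by simp
  qed simp
qed

lemma nat_triangular_pred: "nat (int k * (int k - 1) div 2) = k choose 2"
proof (cases k)
  case (Suc m)
  have "int k * (int k - 1) div 2 = int (k * (k - 1) div 2)"
    by (simp add: Suc zdiv_int algebra_simps)
  then show ?thesis by (simp add: choose_two)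
qed simp

lemma nat_triangular: "nat (int k * (int k + 1) div 2) = (k choose 2) + k"
proof -
  have "nat (int k * (int k + 1) div 2) = Suc k choose 2"
    using nat_triangular_pred[of "Suc k"] by (simp add: algebra_simps)
  then show ?thesis by (simp add: numeral_2_eq_2)
qed

lemma theta_term_of_nat: "theta_term x y (int k) = (x * y) ^ (k choose 2) * x ^ k"
  by (simp add: theta_term_def nat_triangular nat_triangular_pred power_add power_mult_distrib)

text \<open>Negating \<open>n\<close> swaps the two triangular exponents, so the negative half of
  the series is a nonnegative half with \<open>x\<close> and \<open>y\<close> exchanged.\<close>

lemma theta_term_uminus: "theta_term x y (- n) = theta_term y x n"
  by (simp add: theta_term_def algebra_simps)

text \<open>The integers are covered by the nonnegative and the nonpositive ones; the overlap at 0
  is harmless for summability. Passing to a subset \<open>A\<close> is possible by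
  completeness.\<close>

lemma theta_term_summable_on:
  assumes "norm (x * y) < 1"
  shows "theta_term x y summable_on A"
proof -
  have nonneg: "theta_term u v summable_on range int" if "norm (u * v) < 1" for u v
  proof -
    have "summable (\<lambda>k. norm (theta_term u v (int k)))"
      using summable_power_choose_two[of "norm (u * v)" "norm u"] that
      by (simp add: theta_term_of_nat norm_mult norm_power)
    then have "(\<lambda>k. theta_term u v (int k)) summable_on UNIV"
      by (rule norm_summable_imp_summable_on)
    then show ?thesis
      by (subst summable_on_reindex) (auto simp: o_def)
  qed
  have "theta_term x y summable_on uminus ` range int"
    using nonneg[of y x] assms
    by (subst summable_on_reindex) (auto simp: o_def theta_term_uminus mult.commute)
  then have "theta_term x y summable_on range int \<union> uminus ` range int"
    using nonneg[OF assms] by (intro summable_on_union)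
  moreover have "range int \<union> uminus ` range int = UNIV"
  proof (intro equalityI subsetI UnCI)
    fix n :: int
    assume "n \<notin> uminus ` range int"
    then show "n \<in> range int"
      by (cases n rule: int_cases2) auto
  qed simp
  ultimately show ?thesis
    by (metis summable_on_subset_banach subset_UNIV)
qed

lemma theta_term_mult:
  "theta_term (c * x) (c * y) n = c ^ nat (n\<^sup>2) * theta_term x y n"
proof -
  have "n * (n + 1) div 2 + n * (n - 1) div 2 = (n * (n + 1) + n * (n - 1)) div 2"
    \<comment> \<open>The division splits because products of consecutive integers are even.\<close>
    by (rule div_add[symmetric]) auto
  also have "\<dots> = n\<^sup>2"
    by (simp add: algebra_simps power2_eq_square)
  finally have "n * (n + 1) div 2 + n * (n - 1) div 2 = n\<^sup>2" .
  moreover have "0 \<le> n * (n + 1)" "0 \<le> n * (n - 1)"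
    by (auto simp: zero_le_mult_iff)
  ultimately have "nat (n\<^sup>2) = nat (n * (n + 1) div 2) + nat (n * (n - 1) div 2)"
    by (metis nat_add_distrib pos_imp_zdiv_nonneg_iff zero_less_numeral)
  then show ?thesis
    by (simp add: theta_term_def power_mult_distrib power_add mult_ac)
qed

text \<open>Let \<open>i\<close> and \<open>i - m\<close> be the two exponents at \<open>m\<close>.
  Those at \<open>3 * m\<close> are 9i - 3m = 6i + 3(i - m) and 9i - 6m = 3i + 6(i - m), whence the
  powers 6 and 3.\<close>

lemma theta_term_triple:
  "theta_term x y (3 * m) = theta_term (x ^ 6 * y ^ 3) (x ^ 3 * y ^ 6) m"
proof -
  obtain i where i: "m * (m + 1) = 2 * i"
    by (metis dvd_def even_add even_mult_iff odd_one)
  have j: "m * (m - 1) = 2 * (i - m)" "3 * m * (3 * m + 1) = 2 * (9 * i - 3 * m)"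
    "3 * m * (3 * m - 1) = 2 * (9 * i - 6 * m)"
    using i by (auto simp: algebra_simps)
  \<comment> \<open>Nonnegativity of \<open>i\<close> and \<open>i - m\<close> lets
    \<open>nat\<close> distribute over these combinations.\<close>
  have "0 \<le> m * (m + 1)" "0 \<le> m * (m - 1)"
    by (auto simp: zero_le_mult_iff)
  then have "0 \<le> i" "m \<le> i"
    using i j by auto
  then have "nat (9 * i - 3 * m) = 6 * nat i + 3 * nat (i - m)"
    "nat (9 * i - 6 * m) = 3 * nat i + 6 * nat (i - m)"
    by auto
  then show ?thesis
    unfolding theta_term_def j i
    by (simp add: power_mult_distrib power_add mult_ac flip: power_mult)
qed

text \<open>Only the exponent modulo 3 matters, and a square is 0 or 1 modulo 3.\<close>

lemma cube_root_of_unity_power_square: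
  fixes w :: complex
  assumes "w ^ 3 = 1"
  shows "w ^ nat (n\<^sup>2) = (if 3 dvd n then 1 else w)"
proof -
  have "w ^ nat (n\<^sup>2) = w ^ (nat (n\<^sup>2) mod 3)"
    using assms by (metis mod_mult_div_eq mult.right_neutral power_add power_mult power_one)
  also have "nat (n\<^sup>2) mod 3 = nat ((n mod 3)\<^sup>2 mod 3)"
    by (simp add: nat_mod_distrib power_mod)
  also have "w ^ \<dots> = (if 3 dvd n then 1 else w)"
  proof -
    have "n mod 3 = 0 \<or> n mod 3 = 1 \<or> n mod 3 = 2"
      by presburger
    then show ?thesis
      by (elim disjE) (simp_all add: dvd_eq_mod_eq_0)
  qed
  finally show ?thesis .
qed

theorem corollary2p4:
  fixes \<omega> a b :: complex
  assumes "primitive_root_of_unity 3 \<omega>"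
    and "a \<noteq> 0" and "b \<noteq> 0"
    and "norm (a * b) < 1"
  shows "ramanujan_theta (\<omega> * a) (\<omega> * b) =
    \<omega> * ramanujan_theta a b + (1 - \<omega>) * ramanujan_theta (a ^ 6 * b ^ 3) (a ^ 3 * b ^ 6)"
proof -
  let ?t = "theta_term a b"
  \<comment> \<open>Extension by zero keeps all sums over the same index set, so the identity can be
    split termwise.\<close>
  let ?s = "\<lambda>n. if 3 dvd n then ?t n else 0"
  have "\<omega> ^ 3 = 1"
    using assms(1) by (simp add: primitive_root_of_unity_def)
  then have split: "theta_term (\<omega> * a) (\<omega> * b) n = \<omega> * ?t n + (1 - \<omega>) * ?s n" for n
    by (simp add: theta_term_mult cube_root_of_unity_power_square algebra_simps)
  have multiples: "{n::int. 3 dvd n} = range ((*) 3)"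
    by (auto simp: dvd_def)
  have t: "?t summable_on A" for A
    using assms(4) by (rule theta_term_summable_on)
  have s: "?s summable_on UNIV"
    using t[of "{n. 3 dvd n}"] by (rule summable_on_cong_neutral[THEN iffD1, rotated -1]) auto
  have "infsum ?s UNIV = infsum ?t {n. 3 dvd n}"
    by (rule infsum_cong_neutral) auto
  also have "\<dots> = ramanujan_theta (a ^ 6 * b ^ 3) (a ^ 3 * b ^ 6)"
    unfolding multiples ramanujan_theta_eq_infsum
    by (subst infsum_reindex) (auto simp: inj_on_def o_def theta_term_triple)
  finally have sum_s: "infsum ?s UNIV = ramanujan_theta (a ^ 6 * b ^ 3) (a ^ 3 * b ^ 6)" .
  have "ramanujan_theta (\<omega> * a) (\<omega> * b) = (\<Sum>\<^sub>\<infinity>n. \<omega> * ?t n + (1 - \<omega>) * ?s n)"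
    unfolding ramanujan_theta_eq_infsum by (rule infsum_cong) (rule split)
  also have "\<dots> = (\<Sum>\<^sub>\<infinity>n. \<omega> * ?t n) + (\<Sum>\<^sub>\<infinity>n. (1 - \<omega>) * ?s n)"
    by (intro infsum_add summable_on_cmult_right t s)
  also have "\<dots> = \<omega> * infsum ?t UNIV + (1 - \<omega>) * infsum ?s UNIV"
    by (simp only: infsum_cmult_right')
  finally show ?thesis
    by (simp only: sum_s ramanujan_theta_eq_infsum)
qed

end
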